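(* Let $\mathbf E=(E,+,{}',0,1)$ be a monotonous effect algebra with induced order $\leq$, and define, for $x,y\in E$, $x\odot y:=(x'+y')'$, defined if and only if $x'\leq y$, and $x\rightarrow y:=x'+L(x,y)=\{x'+u\mid u\in L(x,y)\}\subseteq E$. Then $(E,\leq,\odot,\rightarrow,{}',0,1)$ is a divisible commutative unsharp residuated poset.
   Context: An effect algebra is a partial algebra $(E,+,{}',0,1)$ of type $(2,1,0,0)$ where $(E,{}',0,1)$ is an algebra and $+$ is a partial binary operation such that for all $x,y,z\in E$: (E1) $x+y$ is defined iff $y+x$ is defined, and then $x+y=y+x$; (E2) $(x+y)+z$ is defined iff $x+(y+z)$ is defined, and then they are equal; (E3) $x'$ is the unique $u\in E$ with $x+u=1$; (E4) if $1+x$ is defined then $x=0$. The induced order is $x\leq y$ iff there is $z\in E$ with $x+z=y$. For a poset $(P,\leq)$ and $A\subseteq P$: $L(A)=\{x\in P\mid x\leq y\ \forall y\in A\}$, $U(A)=\{x\in P\mid y\leq x\ \forall y\in A\}$; we write $L(a,b)=L(\{a,b\})$, $U(a,b)=U(\{a,b\})$, $LU(A)=L(U(A))$, $UL(a,b)=U(L(\{a,b\}))$. For subsets $A,B$, $A\leq B$ means $x\leq y$ for all $x\in A,y\in B$ (and similarly with single elements). Operations are extended elementwise to subsets: $x+A=\{x+y\mid y\in A\}$, $A\odot y=\{u\odot y\mid u\in A\}$, $y\odot A$ similarly, $A'=\{a'\mid a\in A\}$. The effect algebra is monotonous if for all $x\in E$ and all non-empty $A,B\subseteq E$: $A\cup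 B\leq x'$ and $L(A)\leq U(B)$ imply $L(x+A)\leq U(x+B)$. A partial monoid $(A,\odot,1)$ is a set with a partial binary operation such that $(x\odot y)\odot z$ is defined iff $x\odot(y\odot z)$ is defined and then they are equal, and $x\odot1=1\odot x=x$ for all $x$; it is commutative if $x\odot y$ is defined iff $y\odot x$ is defined and then $x\odot y=y\odot x$. A commutative unsharp residuated poset is a tuple $(C,\leq,\odot,\rightarrow,{}',0,1)$ with $\rightarrow:C^2\to 2^C$ such that for all $x,y,z\in C$: (C1) $(C,\leq,{}',0,1)$ is a bounded poset with an antitone involution ${}'$; (C2) $(C,\odot,1)$ is a commutative partial monoid in which $x\odot y$ is defined iff $x'\leq y$, and $z'\leq x\leq y$ implies $x\odot z\leq y\odot z$; (C3) $L(U(x,y')\odot y)\leq UL(y,z)$ if and only if $LU(x,y')\leq U(y\rightarrow z)$; (C4) $x\rightarrow 0=\{x'\}$. It is divisible if $x\leq y$ implies $y\odot(y\rightarrow x)=L(x)$ for all $x,y\in C$. *)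

theory Defs
  imports Main
begin

text \<open>
  A partial binary operation on a carrier set is a function into the option type, with value
  \<^term>\<open>None\<close> where it is undefined. An equation between \<^const>\<open>Option.bind\<close> terms then says that
  either both sides are undefined or both are defined and equal. Values outside the carrier
  are never constrained or used.
\<close>

definition lower :: "'a set \<Rightarrow> ('a \<Rightarrow> 'a \<Rightarrow> bool) \<Rightarrow> 'a set \<Rightarrow> 'a set" where
  "lower C le A = {x \<in> C. \<forall>y\<in>A. le x y}"

definition upper :: "'a set \<Rightarrow> ('a \<Rightarrow> 'a \<Rightarrow> bool) \<Rightarrow> 'a set \<Rightarrow> 'a set" where
  "upper C le A = {x \<in> C. \<forall>y\<in>A. le y x}"

definition set_le :: "('a \<Rightarrow> 'a \<Rightarrow> bool) \<Rightarrow> 'a set \<Rightarrow> 'a set \<Rightarrow> bool" where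
  "set_le le A B \<longleftrightarrow> (\<forall>x\<in>A. \<forall>y\<in>B. le x y)"

text \<open>
  Elementwise extension of a partial map. Arguments where the map is undefined contribute
  nothing; in the axioms below, wherever the ordering assumptions do not already guarantee
  definedness, it is required separately.
\<close>

definition pimage :: "('a \<Rightarrow> 'b option) \<Rightarrow> 'a set \<Rightarrow> 'b set" where
  "pimage f A = {z. \<exists>u\<in>A. f u = Some z}"

locale effect_algebra =
  fixes E :: "'a set"
    and add :: "'a \<Rightarrow> 'a \<Rightarrow> 'a option"
    and neg :: "'a \<Rightarrow> 'a"
    and zero one :: 'a
  assumes zero_closed: "zero \<in> E"
    and one_closed: "one \<in> E"
    and neg_closed: "x \<in> E \<Longrightarrow> neg x \<in> E"
    and add_closed: "x \<in> E \<Longrightarrow> y \<in> E \<Longrightarrow> add x y = Some z \<Longrightarrow> z \<in> E"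
    and E1: "x \<in> E \<Longrightarrow> y \<in> E \<Longrightarrow> add x y = add y x"
    and E2: "x \<in> E \<Longrightarrow> y \<in> E \<Longrightarrow> z \<in> E \<Longrightarrow>
      Option.bind (add x y) (\<lambda>w. add w z) = Option.bind (add y z) (\<lambda>w. add x w)"
    and E3: "x \<in> E \<Longrightarrow> u \<in> E \<Longrightarrow> add x u = Some one \<longleftrightarrow> u = neg x"
    and E4: "x \<in> E \<Longrightarrow> add one x \<noteq> None \<Longrightarrow> x = zero"

definition induced_le :: "'a set \<Rightarrow> ('a \<Rightarrow> 'a \<Rightarrow> 'a option) \<Rightarrow> 'a \<Rightarrow> 'a \<Rightarrow> bool" where
  "induced_le E add x y \<longleftrightarrow> (\<exists>z\<in>E. add x z = Some y)"

locale monotonous_effect_algebra = effect_algebra E add neg zero one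
  for E :: "'a set" and add neg zero one +
  assumes monotonous:
    "\<lbrakk>x \<in> E; A \<subseteq> E; B \<subseteq> E; A \<noteq> {}; B \<noteq> {};
      set_le (induced_le E add) (A \<union> B) {neg x};
      set_le (induced_le E add)
        (lower E (induced_le E add) A) (upper E (induced_le E add) B)\<rbrakk> \<Longrightarrow>
      set_le (induced_le E add)
        (lower E (induced_le E add) (pimage (add x) A))
        (upper E (induced_le E add) (pimage (add x) B))"

definition ea_odot ::
  "'a set \<Rightarrow> ('a \<Rightarrow> 'a \<Rightarrow> 'a option) \<Rightarrow> ('a \<Rightarrow> 'a) \<Rightarrow> 'a \<Rightarrow> 'a \<Rightarrow> 'a option" where
  "ea_odot E add neg x y =
    (if induced_le E add (neg x) y then map_option neg (add (neg x) (neg y)) else None)"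

definition ea_imp ::
  "'a set \<Rightarrow> ('a \<Rightarrow> 'a \<Rightarrow> 'a option) \<Rightarrow> ('a \<Rightarrow> 'a) \<Rightarrow> 'a \<Rightarrow> 'a \<Rightarrow> 'a set" where
  "ea_imp E add neg x y = pimage (add (neg x)) (lower E (induced_le E add) {x, y})"

locale bounded_poset_antitone_involution =
  fixes C :: "'a set"
    and le :: "'a \<Rightarrow> 'a \<Rightarrow> bool"
    and neg :: "'a \<Rightarrow> 'a"
    and zero one :: 'a
  assumes le_refl: "reflp_on C le"
    and le_antisym: "antisymp_on C le"
    and le_trans: "transp_on C le"
    and zero_closed: "zero \<in> C"
    and one_closed: "one \<in> C"
    and zero_least: "x \<in> C \<Longrightarrow> le zero x"
    and one_greatest: "x \<in> C \<Longrightarrow> le x one"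
    and neg_closed: "x \<in> C \<Longrightarrow> neg x \<in> C"
    and neg_antitone: "x \<in> C \<Longrightarrow> y \<in> C \<Longrightarrow> le x y \<Longrightarrow> le (neg y) (neg x)"
    and neg_involution: "x \<in> C \<Longrightarrow> neg (neg x) = x"

locale partial_monoid =
  fixes C :: "'a set"
    and odot :: "'a \<Rightarrow> 'a \<Rightarrow> 'a option"
    and one :: 'a
  assumes unit_closed: "one \<in> C"
    and odot_closed: "x \<in> C \<Longrightarrow> y \<in> C \<Longrightarrow> odot x y = Some z \<Longrightarrow> z \<in> C"
    and odot_assoc: "x \<in> C \<Longrightarrow> y \<in> C \<Longrightarrow> z \<in> C \<Longrightarrow>
      Option.bind (odot x y) (\<lambda>w. odot w z) = Option.bind (odot y z) (\<lambda>w. odot x w)"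
    and odot_unit_right: "x \<in> C \<Longrightarrow> odot x one = Some x"
    and odot_unit_left: "x \<in> C \<Longrightarrow> odot one x = Some x"

locale commutative_partial_monoid = partial_monoid +
  assumes odot_comm: "x \<in> C \<Longrightarrow> y \<in> C \<Longrightarrow> odot x y = odot y x"

locale commutative_unsharp_residuated_poset =
  bounded_poset_antitone_involution C le neg zero one +
  commutative_partial_monoid C odot one
  for C :: "'a set"
    and le :: "'a \<Rightarrow> 'a \<Rightarrow> bool"
    and odot :: "'a \<Rightarrow> 'a \<Rightarrow> 'a option"
    and imp :: "'a \<Rightarrow> 'a \<Rightarrow> 'a set"
    and neg :: "'a \<Rightarrow> 'a"
    and zero one :: 'a +
  assumes imp_closed: "x \<in> C \<Longrightarrow> y \<in> C \<Longrightarrow> imp x y \<subseteq> C"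
    and odot_defined: "x \<in> C \<Longrightarrow> y \<in> C \<Longrightarrow> odot x y \<noteq> None \<longleftrightarrow> le (neg x) y"
    and odot_mono: "x \<in> C \<Longrightarrow> y \<in> C \<Longrightarrow> z \<in> C \<Longrightarrow> le (neg z) x \<Longrightarrow> le x y \<Longrightarrow>
      \<exists>a b. odot x z = Some a \<and> odot y z = Some b \<and> le a b"
    and unsharp_adjointness: "x \<in> C \<Longrightarrow> y \<in> C \<Longrightarrow> z \<in> C \<Longrightarrow>
      set_le le (lower C le (pimage (\<lambda>u. odot u y) (upper C le {x, neg y})))
        (upper C le (lower C le {y, z}))
      \<longleftrightarrow>
      set_le le (lower C le (upper C le {x, neg y})) (upper C le (imp y z))"
    and imp_zero: "x \<in> C \<Longrightarrow> imp x zero = {neg x}"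

locale divisible_commutative_unsharp_residuated_poset =
  commutative_unsharp_residuated_poset C le odot imp neg zero one
  for C :: "'a set" and le odot imp neg zero one +
  assumes divisible_defined:
      "x \<in> C \<Longrightarrow> y \<in> C \<Longrightarrow> le x y \<Longrightarrow> w \<in> imp y x \<Longrightarrow> odot y w \<noteq> None"
    and divisible:
      "x \<in> C \<Longrightarrow> y \<in> C \<Longrightarrow> le x y \<Longrightarrow> pimage (odot y) (imp y x) = lower C le {x}"

end

(*
  Translation by y' turns the two sides of adjointness into each other: u \<odot> y inverts
  v \<mapsto> y' + v between the elements below y and those above y', so
  y' + (U(x,y') \<odot> y) = U(x,y') and (y \<rightarrow> z) \<odot> y = L(y,z). One implication is therefore
  monotonicity applied to U(x,y') \<odot> y and L(y,z). For the converse one needs that translation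
  also reflects L(A) \<le> U(B); this is monotonicity applied to the sets of orthosupplements,
  since the antitone involution exchanges the roles of A and B.
*)

theory Submission
  imports Defs
begin

context effect_algebra
begin

abbreviation le (infix "\<preceq>" 50) where "x \<preceq> y \<equiv> induced_le E add x y"
abbreviation "L \<equiv> lower E (induced_le E add)"
abbreviation "U \<equiv> upper E (induced_le E add)"
abbreviation "odot \<equiv> ea_odot E add neg"
abbreviation "imp \<equiv> ea_imp E add neg"

section \<open>Cancellation, the induced order and orthosupplements\<close>

lemma leI: "z \<in> E \<Longrightarrow> add x z = Some y \<Longrightarrow> x \<preceq> y"
  unfolding induced_le_def by blast

lemma leE:
  assumes "x \<preceq> y"
  obtains z where "z \<in> E" "add x z = Some y"
  using assms unfolding induced_le_def by blast

lemma add_neg: "x \<in> E \<Longrightarrow> add x (neg x) = Some one"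
  using E3 neg_closed by blast

lemma neg_neg [simp]:
  assumes "x \<in> E"
  shows "neg (neg x) = x"
proof -
  have "add (neg x) x = Some one"
    using E1[OF neg_closed[OF assms] assms] add_neg[OF assms] by simp
  then show ?thesis
    using E3[OF neg_closed[OF assms] assms] by simp
qed

lemma neg_one: "neg one = zero"
  using E4[of "neg one"] add_neg neg_closed one_closed by simp

text \<open>E2 is split into two elimination rules: if one bracketing is defined, the inner sum of
  the other exists as well. The arguments on order and cancellation then need no
  \<open>Option.bind\<close>.\<close>

lemma add_assoc_right:
  assumes "x \<in> E" "y \<in> E" "z \<in> E" "add x y = Some w" "add w z = Some v"
  obtains u where "u \<in> E" "add y z = Some u" "add x u = Some v"
proof -
  have "Option.bind (add y z) (add x) = Some v"
    using E2[OF assms(1-3)] assms(4,5) by simp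
  then obtain u where "add y z = Some u" "add x u = Some v"
    by (auto simp: bind_eq_Some_conv)
  then show ?thesis
    using that[of u] add_closed[OF assms(2,3)] by blast
qed

lemma add_assoc_left:
  assumes "x \<in> E" "y \<in> E" "z \<in> E" "add y z = Some u" "add x u = Some v"
  obtains w where "w \<in> E" "add x y = Some w" "add w z = Some v"
proof -
  have "Option.bind (add x y) (\<lambda>w. add w z) = Some v"
    using E2[OF assms(1-3)] assms(4,5) by simp
  then obtain w where "add x y = Some w" "add w z = Some v"
    by (auto simp: bind_eq_Some_conv)
  then show ?thesis
    using that[of w] add_closed[OF assms(1,2)] by blast
qed

text \<open>Reassociating (x' + x) + 0 = 1 + 0 = 1 shows that x + 0 is an orthosupplement of x', and
  the only one is x'' = x.\<close>

lemma add_zero: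
  assumes x: "x \<in> E"
  shows "add x zero = Some x"
proof -
  have "add (neg x) x = Some one"
    using E1[of "neg x" x] add_neg neg_closed x by simp
  moreover have "add one zero = Some one"
    using add_neg[OF one_closed] by (simp add: neg_one)
  ultimately obtain u where "u \<in> E" "add x zero = Some u" "add (neg x) u = Some one"
    using add_assoc_right x neg_closed zero_closed by metis
  then show ?thesis
    using E3 neg_closed neg_neg x by metis
qed

lemma zero_add: "x \<in> E \<Longrightarrow> add zero x = Some x"
  using add_zero E1 zero_closed by simp

text \<open>Completing both decompositions of w to 1 by adding w' makes y and z orthosupplements of
  the same element w' + x.\<close>

lemma add_left_cancel:
  assumes "x \<in> E" "y \<in> E" "z \<in> E" "add x y = Some w" "add x z = Some w"
  shows "y = z"
proof -
  have w: "w \<in> E" "add (neg w) w = Some one"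
    using assms add_closed add_neg E1 neg_closed by metis+
  obtain v where v: "v \<in> E" "add (neg w) x = Some v" "add v y = Some one"
    using add_assoc_left[of "neg w" x y] assms w neg_closed by metis
  moreover have "add v z = Some one"
    using add_assoc_left[of "neg w" x z] assms w neg_closed v(2) by (metis option.inject)
  ultimately show ?thesis
    using E3 assms by metis
qed

lemma le_refl': "x \<in> E \<Longrightarrow> x \<preceq> x"
  using leI add_zero zero_closed by blast

lemma le_trans':
  assumes x: "x \<in> E" and "x \<preceq> y" "y \<preceq> z"
  shows "x \<preceq> z"
proof -
  obtain a where a: "a \<in> E" "add x a = Some y" using assms leE by blast
  obtain b where b: "b \<in> E" "add y b = Some z" using assms leE by blast
  obtain c where "c \<in> E" "add a b = Some c" "add x c = Some z"
    using add_assoc_right[OF x a(1) b(1) a(2) b(2)] .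
  then show ?thesis using leI by blast
qed

lemma le_antisym':
  assumes x: "x \<in> E" and "x \<preceq> y" "y \<preceq> x"
  shows "x = y"
proof -
  obtain a where a: "a \<in> E" "add x a = Some y" using assms leE by blast
  obtain b where b: "b \<in> E" "add y b = Some x" using assms leE by blast
  obtain c where c: "c \<in> E" "add a b = Some c" "add x c = Some x"
    using add_assoc_right[OF x a(1) b(1) a(2) b(2)] .
  then have "c = zero"
    using add_left_cancel add_zero x zero_closed by blast
  \<comment> \<open>Here a + b = 0. Since 1 + (a + b) = 1 is defined, so is 1 + a, and E4
    applies.\<close>
  then have "add one a \<noteq> None"
    using add_assoc_left[of one a b zero one] a b c add_zero one_closed by (metis option.distinct(1))
  then have "a = zero"
    using E4 a by blast
  then show ?thesis
    using a add_zero x by simp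
qed

text \<open>Adding w' completes y + x = w to 1, so x + w' is the orthosupplement of y.\<close>

lemma le_neg_if_add:
  assumes x: "x \<in> E" and y: "y \<in> E" and w: "add y x = Some w"
  shows "x \<preceq> neg y"
proof -
  have "w \<in> E" using add_closed[OF y x w] .
  then obtain u where "u \<in> E" "add x (neg w) = Some u" "add y u = Some one"
    using add_assoc_right[OF y x neg_closed w add_neg] by blast
  then show ?thesis
    using E3 y leI neg_closed \<open>w \<in> E\<close> by metis
qed

text \<open>This turns definedness into an order statement. For the converse, x + z = y' makes y +
  (x + z) = 1 defined, hence also y + x.\<close>

lemma add_defined_iff:
  assumes x: "x \<in> E" and y: "y \<in> E"
  shows "add x y \<noteq> None \<longleftrightarrow> x \<preceq> neg y"
proof
  assume "add x y \<noteq> None"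
  then show "x \<preceq> neg y"
    using le_neg_if_add x y E1 by fastforce
next
  assume "x \<preceq> neg y"
  then obtain z where "z \<in> E" "add x z = Some (neg y)" by (rule leE)
  then have "add y x \<noteq> None"
    using add_assoc_left[of y x z] add_neg x y by (metis option.distinct(1))
  then show "add x y \<noteq> None" using E1[OF x y] by simp
qed

text \<open>Both inequalities express definedness of the same commutative sum; antitonicity of
  \<open>neg\<close> follows from this.\<close>

lemma le_neg_swap: "x \<in> E \<Longrightarrow> y \<in> E \<Longrightarrow> x \<preceq> neg y \<longleftrightarrow> y \<preceq> neg x"
  using add_defined_iff[of x y] add_defined_iff[of y x] E1[of x y] by simp

lemma neg_le_neg_iff: "x \<in> E \<Longrightarrow> y \<in> E \<Longrightarrow> neg x \<preceq> neg y \<longleftrightarrow> y \<preceq> x"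
  using le_neg_swap[of "neg x" y] neg_closed by simp

lemma zero_le: "x \<in> E \<Longrightarrow> zero \<preceq> x"
  using leI zero_add by blast

lemma le_one: "x \<in> E \<Longrightarrow> x \<preceq> one"
  using leI add_neg neg_closed by blast

section \<open>The product as addition conjugated by the orthosupplement\<close>

lemma odot_eq:
  assumes "x \<in> E" "y \<in> E"
  shows "odot x y = map_option neg (add (neg x) (neg y))"
  using assms add_defined_iff[of "neg x" "neg y"] neg_closed
  unfolding ea_odot_def by auto

lemma odot_comm: "x \<in> E \<Longrightarrow> y \<in> E \<Longrightarrow> odot x y = odot y x"
  using odot_eq E1[of "neg x" "neg y"] neg_closed by simp

lemma odot_one: "x \<in> E \<Longrightarrow> odot x one = Some x"
  by (simp add: odot_eq one_closed neg_one add_zero neg_closed)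

lemma odot_defined_iff:
  "x \<in> E \<Longrightarrow> y \<in> E \<Longrightarrow> odot x y \<noteq> None \<longleftrightarrow> neg x \<preceq> y"
  using odot_eq add_defined_iff[of "neg x" "neg y"] neg_closed by simp

lemma odot_in:
  assumes "x \<in> E" "y \<in> E" "odot x y = Some z"
  shows "z \<in> E"
proof -
  obtain w where "add (neg x) (neg y) = Some w" "z = neg w"
    using assms odot_eq by auto
  then show ?thesis
    using add_closed assms neg_closed by blast
qed

lemma odot_assoc:
  assumes x: "x \<in> E" and y: "y \<in> E" and z: "z \<in> E"
  shows "Option.bind (odot x y) (\<lambda>w. odot w z) = Option.bind (odot y z) (odot x)"
proof -
  have "Option.bind (odot x y) (\<lambda>w. odot w z)
      = map_option neg (Option.bind (add (neg x) (neg y)) (\<lambda>w. add w (neg z)))"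
    using add_closed[of "neg x" "neg y"] x y z neg_closed
    by (cases "add (neg x) (neg y)") (auto simp: odot_eq)
  moreover have "Option.bind (odot y z) (odot x)
      = map_option neg (Option.bind (add (neg y) (neg z)) (add (neg x)))"
    using add_closed[of "neg y" "neg z"] x y z neg_closed
    by (cases "add (neg y) (neg z)") (auto simp: odot_eq)
  ultimately show ?thesis
    using E2[of "neg x" "neg y" "neg z"] x y z neg_closed by simp
qed

text \<open>Writing x' = y' + d gives z' + x' = (z' + y') + d, so z' + y' \<le> z' + x'; taking
  orthosupplements reverses this.\<close>

lemma odot_mono_left:
  assumes x: "x \<in> E" and y: "y \<in> E" and z: "z \<in> E" and zx: "neg z \<preceq> x" and xy: "x \<preceq> y"
  shows "\<exists>a b. odot x z = Some a \<and> odot y z = Some b \<and> a \<preceq> b"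
proof -
  have n: "neg x \<in> E" "neg y \<in> E" "neg z \<in> E"
    using x y z neg_closed by auto
  have "add (neg z) (neg x) \<noteq> None"
    using add_defined_iff n zx x by simp
  then obtain a where a: "add (neg z) (neg x) = Some a" by blast
  have "neg y \<preceq> neg x" using neg_le_neg_iff x y xy by blast
  then obtain d where d: "d \<in> E" "add (neg y) d = Some (neg x)" by (rule leE)
  obtain b where b: "b \<in> E" "add (neg z) (neg y) = Some b" "add b d = Some a"
    using add_assoc_left[OF n(3) n(2) d(1) d(2) a] .
  have "odot x z = Some (neg a)" "odot y z = Some (neg b)"
    using a b odot_comm[of _ z] odot_eq[of z] x y z by simp_all
  moreover have "a \<in> E" "b \<preceq> a"
    using a b d n add_closed leI by blast+
  ultimately show ?thesis
    using neg_le_neg_iff b by blast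
qed

text \<open>Completing y' + v = w to 1 by w' gives v + w' = y. Completing that sum by y' gives w' +
  y' = v'.\<close>

lemma odot_translate:
  assumes y: "y \<in> E" and v: "v \<in> E" and w: "add (neg y) v = Some w"
  shows "odot w y = Some v"
proof -
  have wE: "w \<in> E" using add_closed neg_closed v w y by blast
  obtain u where u: "u \<in> E" "add v (neg w) = Some u" "add (neg y) u = Some one"
    using add_assoc_right[of "neg y" v "neg w"] v w y wE add_neg neg_closed by metis
  then have "u = y" using E3 neg_closed y by fastforce
  then obtain t where t: "t \<in> E" "add (neg w) (neg y) = Some t" "add v t = Some one"
    using add_assoc_right[of v "neg w" "neg y"] u v y wE add_neg neg_closed by metis
  then have "t = neg v" using E3 v by blast
  then show ?thesis
    using t odot_eq wE y v by simp
qed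

text \<open>Definedness of the product puts u above y', so u = y' + z for some z, and
  \<open>odot_translate\<close> identifies z with v.\<close>

lemma translate_odot:
  assumes y: "y \<in> E" and u: "u \<in> E" and v: "odot u y = Some v"
  shows "add (neg y) v = Some u"
proof -
  have "neg y \<preceq> u"
    using odot_defined_iff[OF y u] odot_comm u v y by simp
  then obtain z where z: "z \<in> E" "add (neg y) z = Some u" by (rule leE)
  then show ?thesis using odot_translate y v by fastforce
qed

section \<open>Duality for bounds, and images under translation and product\<close>

lemma set_le_lower_upper_neg:
  assumes A: "A \<subseteq> E" and B: "B \<subseteq> E" and le: "set_le (\<preceq>) (L A) (U B)"
  shows "set_le (\<preceq>) (L (neg ` B)) (U (neg ` A))"
proof -
  have "p \<preceq> q" if p: "p \<in> L (neg ` B)" and q: "q \<in> U (neg ` A)" for p q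
  proof -
    have E: "p \<in> E" "q \<in> E" using p q by (auto simp: lower_def upper_def)
    have "b \<preceq> neg p" if "b \<in> B" for b
      using that p B E le_neg_swap[of p b] by (auto simp: lower_def)
    then have "neg p \<in> U B"
      using E neg_closed by (auto simp: upper_def)
    moreover have "neg q \<preceq> a" if "a \<in> A" for a
      using that q A E neg_closed le_neg_swap[of "neg q" "neg a"]
        neg_le_neg_iff[of q "neg a"] by (auto simp: upper_def)
    then have "neg q \<in> L A"
      using E neg_closed by (auto simp: lower_def)
    ultimately show ?thesis
      using le E neg_le_neg_iff by (auto simp: set_le_def)
  qed
  then show ?thesis by (simp add: set_le_def)
qed

lemma pimage_add_subset: "x \<in> E \<Longrightarrow> A \<subseteq> E \<Longrightarrow> pimage (add x) A \<subseteq> E"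
  using add_closed[of x] by (fastforce simp: pimage_def)

lemma imp_subset: "x \<in> E \<Longrightarrow> imp x y \<subseteq> E"
  unfolding ea_imp_def by (rule pimage_add_subset) (auto simp: neg_closed lower_def)

lemma odot_imp:
  assumes y: "y \<in> E"
  shows "pimage (\<lambda>w. odot w y) (imp y z) = L {y, z}"
proof
  show "pimage (\<lambda>w. odot w y) (imp y z) \<subseteq> L {y, z}"
    using odot_translate y by (fastforce simp: ea_imp_def pimage_def lower_def)
  show "L {y, z} \<subseteq> pimage (\<lambda>w. odot w y) (imp y z)"
  proof
    fix v assume v: "v \<in> L {y, z}"
    then have vE: "v \<in> E" "v \<preceq> neg (neg y)" using y by (auto simp: lower_def)
    \<comment> \<open>The bound v \<le> y = y'' is exactly what makes y' + v defined, so every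
      element of \<open>L {y, z}\<close> is reached.\<close>
    then have "add v (neg y) \<noteq> None" using add_defined_iff neg_closed y by blast
    then obtain w where w: "add (neg y) v = Some w"
      using E1 vE neg_closed y by fastforce
    then have "odot w y = Some v" using odot_translate vE y by blast
    then show "v \<in> pimage (\<lambda>w. odot w y) (imp y z)"
      using v w by (auto simp: ea_imp_def pimage_def)
  qed
qed

text \<open>Lying above y' guarantees that each product with y is defined, so \<open>pimage\<close>
  drops no element of \<open>A\<close>.\<close>

lemma translate_odot_image:
  assumes y: "y \<in> E" and A: "A \<subseteq> E" and above: "\<And>u. u \<in> A \<Longrightarrow> neg y \<preceq> u"
  shows "pimage (add (neg y)) (pimage (\<lambda>u. odot u y) A) = A"
proof
  show "pimage (add (neg y)) (pimage (\<lambda>u. odot u y) A) \<subseteq> A"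
    using translate_odot y A by (fastforce simp: pimage_def)
  show "A \<subseteq> pimage (add (neg y)) (pimage (\<lambda>u. odot u y) A)"
  proof
    fix u assume u: "u \<in> A"
    then obtain v where v: "odot u y = Some v"
      using odot_defined_iff[of y u] odot_comm above y A by fastforce
    then show "u \<in> pimage (add (neg y)) (pimage (\<lambda>u. odot u y) A)"
      using translate_odot[OF y _ v] u A by (auto simp: pimage_def)
  qed
qed

text \<open>This exhibits multiplication by y as translation by y' between two orthosupplements, the
  form to which \<open>monotonous\<close> applies.\<close>

lemma odot_image_eq:
  assumes y: "y \<in> E" and A: "A \<subseteq> E"
  shows "pimage (\<lambda>u. odot u y) A = neg ` pimage (add (neg y)) (neg ` A)"
proof -
  have "odot u y = map_option neg (add (neg y) (neg u))" if "u \<in> A" for u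
    using that A y odot_eq[of y u] odot_comm[of u y] by auto
  then have "pimage (\<lambda>u. odot u y) A = pimage (\<lambda>u. map_option neg (add (neg y) (neg u))) A"
    by (simp add: pimage_def)
  then show ?thesis by (auto simp: pimage_def)
qed

lemma imp_above:
  assumes "y \<in> E" "w \<in> imp y z"
  shows "neg y \<preceq> w"
  using assms leI by (auto simp: ea_imp_def pimage_def lower_def)

lemma imp_nonempty:
  assumes "y \<in> E" "z \<in> E"
  shows "imp y z \<noteq> {}"
proof -
  have "neg y \<in> imp y z"
    using assms zero_closed zero_le add_zero neg_closed
    by (auto simp: ea_imp_def pimage_def lower_def intro!: bexI[of _ zero])
  then show ?thesis by blast
qed

lemma imp_zero_eq:
  assumes x: "x \<in> E"
  shows "imp x zero = {neg x}"
proof -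
  have "L {x, zero} = {zero}"
    using x zero_closed zero_le le_antisym' by (auto simp: lower_def)
  then show ?thesis
    using add_zero x neg_closed by (auto simp: ea_imp_def pimage_def)
qed

end

section \<open>Consequences of monotonicity: adjointness and divisibility\<close>

context monotonous_effect_algebra
begin

text \<open>Passing to orthosupplements swaps \<open>A\<close> and \<open>B\<close>,
  \<open>monotonous\<close> translates them by y', and a second passage swaps them back.\<close>

lemma odot_monotonous:
  assumes y: "y \<in> E" and A: "A \<subseteq> E" "A \<noteq> {}" and B: "B \<subseteq> E" "B \<noteq> {}"
    and above: "\<And>u. u \<in> A \<union> B \<Longrightarrow> neg y \<preceq> u"
    and le: "set_le (\<preceq>) (L A) (U B)"
  shows "set_le (\<preceq>) (L (pimage (\<lambda>u. odot u y) A)) (U (pimage (\<lambda>u. odot u y) B))"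
proof -
  have sub: "neg ` A \<subseteq> E" "neg ` B \<subseteq> E"
    using A B neg_closed by auto
  \<comment> \<open>Elements above y' have orthosupplements below y = y'', as
    \<open>monotonous\<close> demands for translation by y'.\<close>
  have "neg u \<preceq> neg (neg y)" if "u \<in> A \<union> B" for u
    using above[OF that] that A B y neg_closed neg_le_neg_iff[of u "neg y"] by auto
  then have "set_le (\<preceq>) (neg ` B \<union> neg ` A) {neg (neg y)}"
    by (auto simp: set_le_def)
  then have "set_le (\<preceq>) (L (pimage (add (neg y)) (neg ` B)))
      (U (pimage (add (neg y)) (neg ` A)))"
    using monotonous[of "neg y" "neg ` B" "neg ` A"] sub y neg_closed A B
      set_le_lower_upper_neg[OF A(1) B(1) le] by blast
  then show ?thesis
    using set_le_lower_upper_neg[of "pimage (add (neg y)) (neg ` B)" "pimage (add (neg y)) (neg ` A)"]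
      pimage_add_subset sub y neg_closed odot_image_eq A B by simp
qed

lemma adjointness:
  assumes x: "x \<in> E" and y: "y \<in> E" and z: "z \<in> E"
  shows "set_le (\<preceq>) (L (pimage (\<lambda>u. odot u y) (U {x, neg y}))) (U (L {y, z}))
    \<longleftrightarrow> set_le (\<preceq>) (L (U {x, neg y})) (U (imp y z))"
    (is "?lhs \<longleftrightarrow> ?rhs")
proof -
  let ?A = "U {x, neg y}"
  let ?P = "pimage (\<lambda>u. odot u y) ?A"
  have A: "?A \<subseteq> E" "\<And>u. u \<in> ?A \<Longrightarrow> neg y \<preceq> u"
    by (auto simp: upper_def)
  \<comment> \<open>The element 1 witnesses that \<open>?A\<close> is nonempty, and its product with
    y, which is y, does the same for \<open>?P\<close>.\<close>
  have one: "one \<in> ?A"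
    using one_closed le_one x y neg_closed by (auto simp: upper_def)
  show ?thesis
  proof
    assume ?lhs
    have P: "?P \<subseteq> E"
      using odot_in[OF _ y] A by (force simp: pimage_def)
    have "y \<in> ?P"
      using one odot_one odot_comm[of one y] y one_closed by (auto simp: pimage_def)
    moreover have "zero \<in> L {y, z}"
      using zero_closed zero_le y z by (auto simp: lower_def)
    \<comment> \<open>Each v in \<open>?P\<close> satisfies y' + v = u for some u in
      \<open>?A\<close>; definedness of this sum bounds v by y.\<close>
    moreover have "v \<preceq> y" if v: "v \<in> ?P" for v
    proof -
      obtain u where "u \<in> ?A" "odot u y = Some v"
        using v by (auto simp: pimage_def)
      then have "add (neg y) v = Some u"
        using translate_odot y A by blast
      then show ?thesis
        using le_neg_if_add[of v "neg y"] v P neg_closed y by auto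
    qed
    then have "set_le (\<preceq>) (?P \<union> L {y, z}) {neg (neg y)}"
      using y by (auto simp: set_le_def lower_def)
    moreover have "L {y, z} \<subseteq> E" by (auto simp: lower_def)
    ultimately have "set_le (\<preceq>) (L (pimage (add (neg y)) ?P))
        (U (pimage (add (neg y)) (L {y, z})))"
      using monotonous[of "neg y" ?P "L {y, z}"] P \<open>?lhs\<close> y neg_closed by blast
    \<comment> \<open>Translation by y' recovers \<open>?A\<close> from \<open>?P\<close> and turns
      \<open>L {y, z}\<close> into \<open>imp y z\<close> by definition.\<close>
    then show ?rhs
      using translate_odot_image[OF y A] by (simp add: ea_imp_def)
  next
    assume ?rhs
    moreover have "\<And>u. u \<in> ?A \<union> imp y z \<Longrightarrow> neg y \<preceq> u"
      using A imp_above[OF y] by blast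
    ultimately have "set_le (\<preceq>) (L ?P) (U (pimage (\<lambda>u. odot u y) (imp y z)))"
      using odot_monotonous[of y ?A "imp y z"] A(1) one y imp_subset[OF y] imp_nonempty[OF y z]
      by blast
    \<comment> \<open>Multiplication by y undoes the translation that defines
      \<open>imp y z\<close>, leaving \<open>L {y, z}\<close>.\<close>
    then show ?lhs
      using odot_imp[OF y] by simp
  qed
qed

lemma odot_imp_divisible:
  assumes x: "x \<in> E" and y: "y \<in> E" and "x \<preceq> y"
  shows "pimage (odot y) (imp y x) = L {x}"
proof -
  have "pimage (odot y) (imp y x) = pimage (\<lambda>w. odot w y) (imp y x)"
    using odot_comm[OF y] imp_subset[OF y] by (force simp: pimage_def)
  also have "\<dots> = L {y, x}" using odot_imp y by blast
  also have "\<dots> = L {x}" using assms le_trans' by (auto simp: lower_def)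
  finally show ?thesis .
qed

end

theorem theorem1:
  fixes E :: "'a set"
    and add :: "'a \<Rightarrow> 'a \<Rightarrow> 'a option"
    and neg :: "'a \<Rightarrow> 'a"
    and zero one :: 'a
  assumes "monotonous_effect_algebra E add neg zero one"
  shows "divisible_commutative_unsharp_residuated_poset E (induced_le E add)
    (ea_odot E add neg) (ea_imp E add neg) neg zero one"
proof -
  interpret monotonous_effect_algebra E add neg zero one by fact
  show ?thesis
  proof (unfold_locales, goal_cases)
    case 1 show ?case using le_refl' by (simp add: reflp_on_def)
  next
    case 2 show ?case using le_antisym' by (simp add: antisymp_on_def)
  next
    case 3 show ?case using le_trans' by (blast intro: transp_onI)
  next
    case 11 then show ?case by (rule odot_in)
  next
    case 12 then show ?case by (rule odot_assoc)
  next
    case 14 then show ?case using odot_comm[OF one_closed] odot_one by simp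
  next
    case 15 then show ?case by (rule odot_comm)
  next
    case 17 then show ?case by (rule odot_defined_iff)
  next
    case 18 then show ?case by (rule odot_mono_left)
  next
    case 19 then show ?case by (rule adjointness)
  next
    \<comment> \<open>Definedness in divisibility: every element of \<open>imp y x\<close> is a sum
      y' + v, hence above y'.\<close>
    case 21 then show ?case
      using odot_defined_iff imp_above imp_subset by blast
  qed (simp_all add: zero_closed one_closed zero_le le_one neg_closed neg_le_neg_iff odot_one
      imp_subset imp_zero_eq odot_imp_divisible)
qed

end
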